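(* Assume the following three conditions. (1) For all $\theta_1,\theta_2\in\Theta$, $f(\cdot,\theta_1)=f(\cdot,\theta_2)$ (a.s.) implies $\theta_1=\theta_2$. (2) For all $\theta\in\Theta$, $\int|\log(f(x,\theta))|f(x,\theta)\,d\mu(x)<\infty$. (3) For all $\theta_0\in\Theta$, $s(\cdot,\theta_0)$ is continuous on $\Theta$ and $\liminf_{x\to b}s(x,\theta_0)>s(\theta_0,\theta_0)$ for all $b\in\mathcal{C}^*(\Theta)\setminus\Theta$. Then for all $\epsilon>0$, $\{-\log(l_n)\}$ (weakly) separates $\mathfrak{A}^\epsilon$ from $\mathfrak{B}^\epsilon$; that is, for all $\theta\in\mathfrak{A}^\epsilon$ and $\phi\in\mathfrak{B}^\epsilon$, $$\limsup_{n\to\infty}\left[-\log(l_n(\theta))+\log(l_n(\phi))\right]<0\quad\text{almost surely}.$$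
   Context: $X_1,X_2,\ldots$ are i.i.d. with probability density function $f(\cdot,\theta_0)$ with respect to a $\sigma$-finite measure $\mu$ on $\mathbb{R}^p$, where $\theta_0$ is the true parameter, belonging to the parameter space $\Theta\subset\mathbb{R}^q$, and $\{f(\cdot,\theta)\}_{\theta\in\Theta}$ is a family of densities with respect to $\mu$. The likelihood function is $l_n(\theta)=\prod_{i=1}^nf(X_i,\theta)$. Put $s(\theta,\theta_0)=-\int\log(f(x,\theta))f(x,\theta_0)\,d\mu(x)$. $\mathcal{C}(\Theta)$ denotes the closure of $\Theta$; $\mathcal{C}^*(\Theta)=\mathcal{C}(\Theta)$ if $\Theta$ is bounded and $\mathcal{C}^*(\Theta)=\mathcal{C}(\Theta)\cup\{\infty\}$ otherwise. $B(\theta_0,\epsilon)=\{x\in\mathbb{R}^q:\|x-\theta_0\|\leqslant\epsilon\}$. Under conditions (1)-(3) of the claim, for every $\epsilon>0$ there exists $\delta(\epsilon)>0$ such that $\{\theta\in\Theta:s(\theta,\theta_0)-s(\theta_0,\theta_0)\leqslant\delta(\epsilon)\}\subset B(\theta_0,\epsilon)$; fix such a $\delta(\epsilon)$ and set $B_s(\theta_0,\epsilon)=\{\theta\in\Theta:s(\theta,\theta_0)-s(\theta_0,\theta_0)\leqslant\delta(\epsilon)\}$, $\mathfrak{A}^\epsilon=B_s(\theta_0,\epsilon)$ and $\mathfrak{B}^\epsilon=\Theta\setminus B_s(\theta_0,\epsilon)$. *)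

theory Defs
  imports "HOL-Probability.Probability"
begin

(* The library logarithm has "ln 0 = 0"; a likelihood may vanish, so log 0 = -infinity is needed. *)
definition elog :: "real \<Rightarrow> ereal" where
  "elog x = (if x = 0 then - \<infinity> else ereal (ln x))"

(* Integral of an extended-real function as positive part minus negative part
   (e2ennreal maps negative numbers to 0). If both parts are infinite, the value is
   the meaningless \<infinity> - \<infinity> = \<infinity>. *)
definition ereal_integral :: "'a measure \<Rightarrow> ('a \<Rightarrow> ereal) \<Rightarrow> ereal" where
  "ereal_integral M g =
     enn2ereal (\<integral>\<^sup>+ x. e2ennreal (g x) \<partial>M) - enn2ereal (\<integral>\<^sup>+ x. e2ennreal (- g x) \<partial>M)"

definition is_density :: "'a measure \<Rightarrow> ('a \<Rightarrow> real) \<Rightarrow> bool" where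
  "is_density \<mu> g \<longleftrightarrow>
     g \<in> borel_measurable \<mu> \<and> (\<forall>x. 0 \<le> g x) \<and> (\<integral>\<^sup>+ x. ennreal (g x) \<partial>\<mu>) = 1"

(* s may take the value \<infinity>. Where f x \<theta>0 = 0 the integrand is 0, also if f x \<theta> = 0,
   since 0 * (- \<infinity>) = 0 in ereal. If f _ \<theta> and f _ \<theta>0 are densities and
   log (f _ \<theta>0) * f _ \<theta>0 is integrable, the positive part of the integrand has finite
   integral, so the case \<infinity> - \<infinity> does not occur and s \<theta> \<theta>0 > - \<infinity>. *)
definition cross_entropy ::
    "'a measure \<Rightarrow> ('a \<Rightarrow> 'b \<Rightarrow> real) \<Rightarrow> 'b \<Rightarrow> 'b \<Rightarrow> ereal" where
  "cross_entropy \<mu> f \<theta> \<theta>\<^sub>0 = - ereal_integral \<mu> (\<lambda>x. elog (f x \<theta>) * ereal (f x \<theta>\<^sub>0))"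

definition likelihood ::
    "('a \<Rightarrow> 'b \<Rightarrow> real) \<Rightarrow> (nat \<Rightarrow> 'w \<Rightarrow> 'a) \<Rightarrow> nat \<Rightarrow> 'w \<Rightarrow> 'b \<Rightarrow> real" where
  "likelihood f X n \<omega> \<theta> = (\<Prod>i\<in>{1..n}. f (X i \<omega>) \<theta>)"

(* The set C* of the closure together with, for unbounded sets, a point at infinity:
   None is the point at infinity. *)
definition extended_closure :: "'b::metric_space set \<Rightarrow> 'b option set" where
  "extended_closure S = Some ` closure S \<union> (if bounded S then {} else {None})"

(* The filter of x tending to b through S, where None means norm x tending to infinity. *)
fun approach_within :: "'b::real_normed_vector option \<Rightarrow> 'b set \<Rightarrow> 'b filter" where
  "approach_within (Some b) S = at b within S"
| "approach_within None S = inf at_infinity (principal S)"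

definition divergence_nbhd ::
    "'a measure \<Rightarrow> ('a \<Rightarrow> 'b \<Rightarrow> real) \<Rightarrow> 'b set \<Rightarrow> 'b \<Rightarrow> real \<Rightarrow> 'b set" where
  "divergence_nbhd \<mu> f \<Theta> \<theta>\<^sub>0 d =
     {\<theta> \<in> \<Theta>. cross_entropy \<mu> f \<theta> \<theta>\<^sub>0 - cross_entropy \<mu> f \<theta>\<^sub>0 \<theta>\<^sub>0 \<le> ereal d}"

definition weakly_separates ::
    "'w measure \<Rightarrow> (nat \<Rightarrow> 'w \<Rightarrow> 'b \<Rightarrow> ereal) \<Rightarrow> 'b set \<Rightarrow> 'b set \<Rightarrow> bool" where
  "weakly_separates M L A B \<longleftrightarrow>
     (\<forall>\<theta>\<in>A. \<forall>\<phi>\<in>B. AE \<omega> in M. limsup (\<lambda>n. L n \<omega> \<theta> - L n \<omega> \<phi>) < 0)"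

end

theory Submission
  imports Defs
begin

text \<open>
Write \<open>P\<close> for the law with density \<open>f(_, \<theta>\<^sub>0)\<close>. The set \<open>\<AA>\<^sup>\<epsilon>\<close> is a sublevel set of the cross entropy
\<open>s(_, \<theta>\<^sub>0)\<close>, and \<open>\<BB>\<^sup>\<epsilon>\<close> is its complement in \<open>\<Theta>\<close>. So for \<open>\<theta>\<close> in the first and \<open>\<phi>\<close> in the second,
\<open>s(\<theta>, \<theta>\<^sub>0) < s(\<phi>, \<theta>\<^sub>0)\<close>, that is, the mean under \<open>P\<close> of \<open>log f(_, \<phi>)\<close> is smaller than that of
\<open>log f(_, \<theta>)\<close>. Since \<open>s(\<theta>\<^sub>0, \<theta>\<^sub>0)\<close> is finite, so is \<open>s(\<theta>, \<theta>\<^sub>0)\<close>. The difference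
\<open>- log l\<^sub>n(\<theta>) + log l\<^sub>n(\<phi>)\<close> is therefore a random walk whose i.i.d. steps have negative mean, and such
a walk tends to \<open>-\<infinity>\<close> almost surely.

The law of large numbers is used only in this one-sided form. It comes from the maximal ergodic
inequality, in Garsia's form: if \<open>W n\<close> is the maximum of \<open>0\<close> and the first \<open>n\<close> partial sums, then
\<open>W (n+1)\<close>, where it is positive, equals the first step plus \<open>W n\<close> of the shifted walk. Because the
shift preserves the law, the first step has nonnegative mean on \<open>{W (n+1) > 0}\<close>, even when this
event is intersected with the shift-invariant event \<open>A\<close> that the walk is unbounded above. On \<open>A\<close>
the maxima are eventually positive, and \<open>A\<close> is independent of the first step; in the limit,
(mean of a step) * (probability of \<open>A\<close>) is nonnegative, so a negative mean forces \<open>A\<close> to be null.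
Adding a small constant to each step turns boundedness into divergence to \<open>-\<infinity>\<close>. These two steps
are \<open>AE_bdd_above_walk_sequence_space\<close> and \<open>iid_negative_drift\<close>.

The steps of the log-likelihood walk can have mean \<open>-\<infinity>\<close>, or even take the value \<open>-\<infinity>\<close>, because
\<open>f(_, \<phi>)\<close> may be small or zero. Only an upper bound for the walk is needed, so \<open>log f(_, \<phi>)\<close> is
replaced by its maximum with \<open>-K\<close>. By monotone convergence the mean of the step is still negative
for some finite \<open>K\<close> (\<open>truncated_expectation_less\<close>). This requires that the positive part of \<open>log f(_, \<phi>)\<close> be integrable under \<open>P\<close>, which
follows from \<open>h log g \<le> h |log h| + g\<close> for densities \<open>g\<close> and \<open>h\<close> (\<open>nn_integral_pos_log_density_finite\<close>).
\<close>

section \<open>Running maxima of partial sums\<close>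

text \<open>
The maximum of the partial sums of \<open>x\<close> of lengths \<open>0, ..., n\<close>. The recursion peels off the first
entry instead of the last one, so that the relation between a walk and its shift, on which the
maximal inequality rests, holds by definition.
\<close>

fun walk_max :: "nat \<Rightarrow> (nat \<Rightarrow> real) \<Rightarrow> real" where
  "walk_max 0 x = 0"
| "walk_max (Suc n) x = max 0 (x 0 + walk_max n (\<lambda>i. x (Suc i)))"

lemma walk_max_nonneg: "0 \<le> walk_max n x"
  by (cases n) auto

lemma walk_max_mono_Suc: "walk_max n x \<le> walk_max (Suc n) x"
proof (induction n arbitrary: x)
  case (Suc n)
  show ?case
    using Suc.IH[of "\<lambda>i. x (Suc i)"] by auto
qed simp

lemma partial_sum_le_walk_max: "k \<le> n \<Longrightarrow> (\<Sum>i<k. x i) \<le> walk_max n x"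
proof (induction n arbitrary: k x)
  case (Suc n)
  show ?case
  proof (cases k)
    case (Suc j)
    have "(\<Sum>i<j. x (Suc i)) \<le> walk_max n (\<lambda>i. x (Suc i))"
      using Suc.prems Suc by (intro Suc.IH) simp
    then show ?thesis
      unfolding Suc by (subst sum.lessThan_Suc_shift) simp
  qed (simp add: walk_max_nonneg)
qed simp

text \<open>
Unfolding the recursion would hide \<open>walk_max (Suc n)\<close> from the measurability prover.
\<close>

declare walk_max.simps(2) [simp del]

abbreviation unbounded_walk :: "(nat \<Rightarrow> real) \<Rightarrow> bool" where
  "unbounded_walk x \<equiv> \<not> bdd_above (range (\<lambda>k. \<Sum>i<k. x i))"

text \<open>
Countable quantifiers make the event visibly measurable.
\<close>

lemma unbounded_walk_iff: "unbounded_walk x \<longleftrightarrow> (\<forall>N::nat. \<exists>k. real N < (\<Sum>i<k. x i))"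
proof -
  have "bdd_above (range (\<lambda>k. \<Sum>i<k. x i)) \<longleftrightarrow> (\<exists>N::nat. \<forall>k. (\<Sum>i<k. x i) \<le> real N)"
    by (meson UNIV_I bdd_above.I2 bdd_above.unfold order_trans rangeI real_arch_simple)
  then show ?thesis
    by (auto simp: not_le)
qed

lemma unbounded_walk_shift: "unbounded_walk (case_nat s \<omega>) \<longleftrightarrow> unbounded_walk \<omega>"
proof -
  have *: "(\<Sum>i<Suc k. case_nat s \<omega> i) = s + (\<Sum>i<k. \<omega> i)" for k
    by (subst sum.lessThan_Suc_shift) simp
  have "bdd_above (range (\<lambda>k. \<Sum>i<k. case_nat s \<omega> i)) \<longleftrightarrow> bdd_above (range (\<lambda>k. \<Sum>i<k. \<omega> i))"
  proof
    assume "bdd_above (range (\<lambda>k. \<Sum>i<k. \<omega> i))"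
    then obtain C where C: "\<And>k. (\<Sum>i<k. \<omega> i) \<le> C"
      by (auto simp: bdd_above_def)
    have "(\<Sum>i<k. case_nat s \<omega> i) \<le> max 0 (s + C)" for k
      using C[of "k - 1"] by (cases k) (auto simp: * simp del: sum.lessThan_Suc)
    then show "bdd_above (range (\<lambda>k. \<Sum>i<k. case_nat s \<omega> i))"
      by (auto simp: bdd_above_def)
  next
    assume "bdd_above (range (\<lambda>k. \<Sum>i<k. case_nat s \<omega> i))"
    then obtain C where C: "\<And>k. (\<Sum>i<k. case_nat s \<omega> i) \<le> C"
      by (auto simp: bdd_above_def)
    have "(\<Sum>i<k. \<omega> i) \<le> C - s" for k
      using C[of "Suc k"] unfolding * by simp
    then show "bdd_above (range (\<lambda>k. \<Sum>i<k. \<omega> i))"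
      by (auto simp: bdd_above_def)
  qed
  then show ?thesis by simp
qed

section \<open>A walk with negative drift is bounded above\<close>

lemma distr_pair_snd:
  assumes "prob_space M" "sigma_finite_measure N"
  shows "distr (M \<Otimes>\<^sub>M N) N snd = N"
proof (rule measure_eqI)
  fix A assume A: "A \<in> sets (distr (M \<Otimes>\<^sub>M N) N snd)"
  interpret M: prob_space M by fact
  interpret N: sigma_finite_measure N by fact
  have "snd -` A \<inter> space (M \<Otimes>\<^sub>M N) = space M \<times> A"
    using A sets.sets_into_space by (fastforce simp: space_pair_measure)
  then show "emeasure (distr (M \<Otimes>\<^sub>M N) N snd) A = emeasure N A"
    using A by (simp add: emeasure_distr N.emeasure_pair_measure_Times M.emeasure_space_1)
qed simp

text \<open>
Garsia's argument on the space of step sequences, with \<open>case_nat s \<omega>\<close> in place of a measure-preserving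
shift: prepending an independent step \<open>s\<close> to a sequence \<open>\<omega>\<close> leaves the product law
unchanged. The first step and the tail are the two coordinates of a product measure, so
the independence of the first step from the tail event \<open>A\<close> is Fubini's theorem.
\<close>

lemma AE_bdd_above_walk_sequence_space:
  fixes Q :: "real measure"
  assumes "prob_space Q" and sets_Q[measurable_cong]: "sets Q = sets borel"
    and int_Q: "integrable Q (\<lambda>s. s)" and neg: "(\<integral>s. s \<partial>Q) < 0"
  shows "AE x in (\<Pi>\<^sub>M i\<in>(UNIV::nat set). Q). bdd_above (range (\<lambda>k. \<Sum>i<k. x i))"
proof -
  interpret Q: prob_space Q by fact
  interpret sequence_space Q
    by (simp add: sequence_space_def product_prob_space_def product_prob_space_axioms_def
        product_sigma_finite_def Q.sigma_finite_measure_axioms assms)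
  let ?shift = "\<lambda>(s, \<omega>). case_nat s \<omega> :: nat \<Rightarrow> real"
  have S: "prob_space S"
    by (rule P.prob_space_axioms)
  have QS: "pair_sigma_finite Q S"
    by (intro pair_sigma_finite.intro Q.sigma_finite_measure_axioms prob_space_imp_sigma_finite S)
  interpret QS: pair_sigma_finite Q S by fact
  interpret QSP: prob_space "Q \<Otimes>\<^sub>M S"
    by (rule prob_space_pair) fact+
  have snd: "distr (Q \<Otimes>\<^sub>M S) S snd = S"
    by (rule distr_pair_snd) (use Q.prob_space_axioms prob_space_imp_sigma_finite[OF S] in auto)
  have fst: "distr (Q \<Otimes>\<^sub>M S) Q fst = Q"
    by (rule prob_space.distr_pair_fst[OF S])
  have [measurable]: "?shift \<in> Q \<Otimes>\<^sub>M S \<rightarrow>\<^sub>M S"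
    by measurable
  have meas_coord[measurable]: "(\<lambda>x. x i) \<in> borel_measurable S" for i
    using measurable_component_singleton[of i UNIV "\<lambda>_. Q"] sets_Q by simp
  have meas_shift: "(\<lambda>x i. x (Suc i)) \<in> S \<rightarrow>\<^sub>M S"
  proof (rule measurable_PiM_single')
    show "(\<lambda>x. x (Suc i)) \<in> S \<rightarrow>\<^sub>M Q" for i
      by (rule measurable_component_singleton) simp
    show "(\<lambda>x i. x (Suc i)) \<in> space S \<rightarrow> (\<Pi>\<^sub>E i\<in>UNIV. space Q)"
      by (simp add: space_PiM PiE_iff)
  qed
  have meas_F[measurable]: "walk_max n \<in> borel_measurable S" for n
  proof (induction n)
    case (Suc n)
    have "(\<lambda>x. walk_max n (\<lambda>i. x (Suc i))) \<in> borel_measurable S"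
      by (rule measurable_compose[OF meas_shift Suc])
    then have "(\<lambda>x. max 0 (x 0 + walk_max n (\<lambda>i. x (Suc i)))) \<in> borel_measurable S"
      by (intro borel_measurable_max borel_measurable_add meas_coord) simp_all
    then show ?case by (simp add: walk_max.simps(2))
  qed simp
  have int_shift: "integrable S g \<longleftrightarrow> integrable (Q \<Otimes>\<^sub>M S) (\<lambda>p. g (?shift p))"
    if [measurable]: "g \<in> borel_measurable S" for g :: "(nat \<Rightarrow> real) \<Rightarrow> real"
    by (subst PiM_iter[symmetric], subst integrable_distr_eq) auto
  have lint_shift: "integral\<^sup>L S g = (\<integral>p. g (?shift p) \<partial>(Q \<Otimes>\<^sub>M S))"
    if [measurable]: "g \<in> borel_measurable S" for g :: "(nat \<Rightarrow> real) \<Rightarrow> real"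
    by (subst PiM_iter[symmetric], subst integral_distr) auto
  have int_snd: "integrable (Q \<Otimes>\<^sub>M S) (\<lambda>p. g (snd p))"
    if "integrable S g" for g :: "(nat \<Rightarrow> real) \<Rightarrow> real"
    using that by (intro integrable_distr[of snd _ S]) (simp_all add: snd)
  have lint_snd: "(\<integral>p. g (snd p) \<partial>(Q \<Otimes>\<^sub>M S)) = integral\<^sup>L S g"
    if [measurable]: "g \<in> borel_measurable S" for g :: "(nat \<Rightarrow> real) \<Rightarrow> real"
    by (subst (2) snd[symmetric], subst integral_distr) auto
  have int_fst: "integrable (Q \<Otimes>\<^sub>M S) fst"
    using int_Q by (intro integrable_distr[of fst _ Q, where f="\<lambda>s. s"]) (simp_all add: fst)
  define A where "A = {x \<in> space S. unbounded_walk x}"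
  have A[measurable]: "A \<in> sets S"
    unfolding A_def unbounded_walk_iff by measurable
  have A_shift: "indicator A (?shift p) = (indicator A (snd p) :: real)"
    if "p \<in> space (Q \<Otimes>\<^sub>M S)" for p
  proof -
    have "?shift p \<in> space S" "snd p \<in> space S"
      using that measurable_space[of ?shift "Q \<Otimes>\<^sub>M S" S] by (auto simp: space_pair_measure)
    then show ?thesis
      using unbounded_walk_shift[of "fst p" "snd p"]
      by (simp add: A_def indicator_def case_prod_beta)
  qed
  have int_F: "integrable S (walk_max n)" for n
  proof (induction n)
    case (Suc n)
    show ?case
      unfolding int_shift[OF meas_F]
      using int_fst int_snd[OF Suc] by (simp add: case_prod_beta walk_max.simps(2))
  qed simp
  have int_FA: "integrable S (\<lambda>x. walk_max n x * indicator A x)" for n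
    using integrable_mult_indicator[OF A int_F[of n]] by (simp add: mult.commute)
  have int_0: "integrable S (\<lambda>x. x 0)"
    by (subst int_shift) (use int_fst in \<open>simp_all add: case_prod_beta\<close>)
  have int_0A: "integrable S (\<lambda>x. x 0 * indicator A x)"
    using integrable_mult_indicator[OF A int_0] by (simp add: mult.commute)
  let ?G = "\<lambda>n x. if 0 < walk_max (Suc n) x then x 0 * indicator A x else 0 :: real"
  have meas_G[measurable]: "?G n \<in> borel_measurable S" for n
    by measurable
  have int_G: "integrable S (?G n)" for n
    by (rule Bochner_Integration.integrable_bound[OF int_0A]) (auto simp: indicator_def)
  \<comment> \<open>Maximal inequality: the mean of the first step over \<open>A\<close> and \<open>{walk_max (Suc n) > 0}\<close> is nonnegative, because it dominates the growth of the mean of the running maximum.\<close>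
  have "0 \<le> integral\<^sup>L S (?G n)" for n
  proof -
    let ?F = "\<lambda>n x. walk_max n x * indicator A x"
    have "integral\<^sup>L S (?F (Suc n)) - integral\<^sup>L S (?F n)
        = (\<integral>p. ?F (Suc n) (?shift p) - ?F n (snd p) \<partial>(Q \<Otimes>\<^sub>M S))"
      using int_FA[of "Suc n"] int_snd[OF int_FA[of n]] lint_shift[of "?F (Suc n)"] lint_snd[of "?F n"]
      by (subst Bochner_Integration.integral_diff) (simp_all add: int_shift)
    also have "\<dots> \<le> (\<integral>p. ?G n (?shift p) \<partial>(Q \<Otimes>\<^sub>M S))"
    proof (intro integral_mono Bochner_Integration.integrable_diff)
      show "integrable (Q \<Otimes>\<^sub>M S) (\<lambda>p. ?F (Suc n) (?shift p))"
        using int_FA[of "Suc n"] by (subst (asm) int_shift) auto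
      show "integrable (Q \<Otimes>\<^sub>M S) (\<lambda>p. ?F n (snd p))"
        by (rule int_snd[OF int_FA])
      show "integrable (Q \<Otimes>\<^sub>M S) (\<lambda>p. ?G n (?shift p))"
        using int_G[of n] by (subst (asm) int_shift) auto
      fix p assume p: "p \<in> space (Q \<Otimes>\<^sub>M S)"
      \<comment> \<open>Where the maximum is positive both sides agree; elsewhere the left side is \<open>- walk_max n\<close>.\<close>
      show "?F (Suc n) (?shift p) - ?F n (snd p) \<le> ?G n (?shift p)"
        unfolding A_shift[OF p] using walk_max_nonneg[of n "snd p"]
        by (auto simp: indicator_def case_prod_beta max_def walk_max.simps(2))
    qed
    also have "\<dots> = integral\<^sup>L S (?G n)"
      by (rule lint_shift[symmetric]) simp
    finally have "integral\<^sup>L S (?F (Suc n)) - integral\<^sup>L S (?F n) \<le> integral\<^sup>L S (?G n)" .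
    moreover have "integral\<^sup>L S (?F n) \<le> integral\<^sup>L S (?F (Suc n))"
      by (intro integral_mono int_FA mult_right_mono walk_max_mono_Suc) auto
    ultimately show ?thesis by simp
  qed
  \<comment> \<open>On \<open>A\<close> some partial sum is positive, so the positivity constraint disappears in the limit.\<close>
  moreover have "(\<lambda>n. integral\<^sup>L S (?G n)) \<longlonglongrightarrow> (\<integral>x. x 0 * indicator A x \<partial>S)"
  proof (rule integral_dominated_convergence)
    show "integrable S (\<lambda>x. \<bar>x 0 * indicator A x\<bar>)"
      using int_0A by simp
    show "AE x in S. (\<lambda>n. ?G n x) \<longlonglongrightarrow> x 0 * indicator A x"
    proof (intro AE_I2 tendsto_eventually)
      fix x
      show "\<forall>\<^sub>F n in sequentially. ?G n x = x 0 * indicator A x"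
      proof (cases "x \<in> A")
        case True
        then obtain k where k: "0 < (\<Sum>i<k. x i)"
          unfolding A_def unbounded_walk_iff by (auto dest: spec[of _ 0])
        have "0 < walk_max (Suc n) x" if "k \<le> n" for n
          using k partial_sum_le_walk_max[of k "Suc n" x] that by simp
        then show ?thesis
          by (intro eventually_sequentiallyI[of k]) (simp)
      qed simp
    qed
  qed (auto simp: indicator_def)
  ultimately have "0 \<le> (\<integral>x. x 0 * indicator A x \<partial>S)"
    by (intro LIMSEQ_le_const) auto
  also have "\<dots> = (\<integral>p. fst p * indicator A (snd p) \<partial>(Q \<Otimes>\<^sub>M S))"
    by (subst lint_shift) (auto intro!: Bochner_Integration.integral_cong dest: A_shift)
  also have "\<dots> = (\<integral>s. (\<integral>\<omega>. s * indicator A \<omega> \<partial>S) \<partial>Q)"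
  proof -
    have "integrable (Q \<Otimes>\<^sub>M S) (\<lambda>p. fst p * indicator A (snd p))"
      by (rule Bochner_Integration.integrable_bound[OF int_fst]) (auto simp: indicator_def)
    then show ?thesis
      using QS.integral_fst[of "\<lambda>s \<omega>. s * indicator A \<omega>"] by (simp add: case_prod_unfold)
  qed
  also have "\<dots> = (\<integral>s. s \<partial>Q) * measure S A"
    by simp
  finally have "measure S A = 0"
    using neg measure_nonneg[of S A] by (auto simp: zero_le_mult_iff)
  then have "emeasure S A = 0"
    by (simp add: P.emeasure_eq_measure)
  then show ?thesis
    using A by (intro AE_I[of _ _ A]) (simp_all add: A_def)
qed

section \<open>Strong divergence of i.i.d. sums with negative mean\<close>

lemma (in prob_space) indep_vars_reindex_inj:
  assumes indep: "indep_vars M' X (h ` I)" and inj: "inj_on h I"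
  shows "indep_vars (\<lambda>i. M' (h i)) (\<lambda>i. X (h i)) I"
  unfolding indep_vars_def2 indep_sets_def
proof (intro conjI ballI allI impI)
  fix J A assume J: "J \<subseteq> I" "J \<noteq> {}" "finite J"
    and A: "A \<in> (\<Pi> j\<in>J. {X (h j) -` B \<inter> space M |B. B \<in> sets (M' (h j))})"
  have inj': "inj_on h J" using J(1) inj inj_on_subset by blast
  let ?B = "\<lambda>j. A (the_inv_into J h j)"
  have B: "?B (h j) = A j" if "j \<in> J" for j
    using that inj' by (simp add: the_inv_into_f_f)
  have "indep_sets (\<lambda>i. {X i -` B \<inter> space M |B. B \<in> sets (M' i)}) (h ` I)"
    using indep by (simp add: indep_vars_def2)
  then have "prob (\<Inter>j\<in>h ` J. ?B j) = (\<Prod>j\<in>h ` J. prob (?B j))"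
    by (rule indep_setsD) (use J A B in auto)
  then show "prob (\<Inter>j\<in>J. A j) = (\<Prod>j\<in>J. prob (A j))"
    using B by (simp add: prod.reindex[OF inj'])
qed (use indep in \<open>auto simp: indep_vars_def2\<close>)

text \<open>
A one-sided strong law. Adding a positive constant \<open>c\<close> to the steps keeps their mean negative, and an
upper bound \<open>C\<close> for the modified sums is a bound \<open>C - c n\<close> for the original ones.
\<close>

lemma (in prob_space) iid_negative_drift:
  fixes D :: "nat \<Rightarrow> 'a \<Rightarrow> real"
  assumes indep: "indep_vars (\<lambda>_. borel) D UNIV"
    and ident: "\<And>i. distr M borel (D i) = distr M borel (D 0)"
    and int: "integrable M (D 0)" and neg: "expectation (D 0) < 0"
  shows "AE \<omega> in M. LIM n sequentially. (\<Sum>i<n. D i \<omega>) :> at_bot"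
proof -
  \<comment> \<open>Half of the drift is kept for boundedness, the other half pushes the sums to \<open>-\<infinity>\<close>.\<close>
  define c where "c = - expectation (D 0) / 2"
  have c: "0 < c" using neg by (simp add: c_def)
  have [measurable]: "random_variable borel (D i)" for i
    using indep by (simp add: indep_vars_def2)
  let ?D = "\<lambda>i \<omega>. D i \<omega> + c"
  define Q where "Q = distr M borel (?D 0)"
  have ident': "distr M borel (?D i) = Q" for i
  proof -
    have "distr M borel (?D i) = distr (distr M borel (D i)) borel (\<lambda>s. s + c)" for i
      by (subst distr_distr) (auto simp: comp_def)
    then show ?thesis by (metis Q_def ident)
  qed
  have Q: "prob_space Q" "sets Q = sets borel"
    by (auto simp: Q_def intro!: prob_space_distr)
  have "integrable Q (\<lambda>s. s)"
    unfolding Q_def using int by (subst integrable_distr_eq) auto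
  moreover have "(\<integral>s. s \<partial>Q) < 0"
    unfolding Q_def using int neg by (subst integral_distr) (auto simp: prob_space c_def)
  ultimately have "AE x in (\<Pi>\<^sub>M i\<in>(UNIV::nat set). Q). bdd_above (range (\<lambda>k. \<Sum>i<k. x i))"
    by (intro AE_bdd_above_walk_sequence_space Q)
  moreover have "(\<Pi>\<^sub>M i\<in>(UNIV::nat set). Q) = distr M (\<Pi>\<^sub>M i\<in>(UNIV::nat set). borel) (\<lambda>\<omega> i. ?D i \<omega>)"
  proof -
    have "indep_vars (\<lambda>_. borel) ?D UNIV"
      using indep by (rule indep_vars_compose2) simp
    then show ?thesis
      by (subst (asm) indep_vars_iff_distr_eq_PiM') (auto simp: ident' restrict_UNIV)
  qed
  ultimately have "AE x in distr M (\<Pi>\<^sub>M i\<in>(UNIV::nat set). borel) (\<lambda>\<omega> i. ?D i \<omega>).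
      bdd_above (range (\<lambda>k. \<Sum>i<k. x i))"
    by metis
  then have "AE \<omega> in M. bdd_above (range (\<lambda>k. \<Sum>i<k. ?D i \<omega>))"
    by (rule AE_distrD[rotated]) (auto intro!: measurable_PiM_single')
  then show ?thesis
  proof eventually_elim
    case (elim \<omega>)
    then obtain C where C: "\<And>k. (\<Sum>i<k. ?D i \<omega>) \<le> C"
      by (auto simp: bdd_above_def)
    have "(\<Sum>i<n. D i \<omega>) \<le> C - c * real n" for n
      using C[of n] by (simp add: sum.distrib mult.commute)
    moreover have "LIM n sequentially. C - c * real n :> at_bot"
      using c by real_asymp
    ultimately show ?case
      by (auto intro: filterlim_at_bot_mono)
  qed
qed

section \<open>Integrals of extended-real functions\<close>

lemma elog_less_infinity: "elog x < \<infinity>"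
  by (simp add: elog_def)

lemma measurable_elog [measurable]: "elog \<in> borel_measurable borel"
  unfolding elog_def[abs_def] by measurable

lemma elog_prod:
  assumes "finite I" "\<And>i. i \<in> I \<Longrightarrow> 0 \<le> g i"
  shows "elog (\<Prod>i\<in>I. g i) = (if \<exists>i\<in>I. g i = 0 then - \<infinity> else ereal (\<Sum>i\<in>I. ln (g i)))"
proof -
  have "ln (\<Prod>i\<in>I. g i) = (\<Sum>i\<in>I. ln (g i))" if "\<forall>i\<in>I. g i \<noteq> 0"
    using that assms by (intro ln_prod) (auto simp: less_le)
  then show ?thesis
    using assms(1) by (auto simp: elog_def)
qed

text \<open>
The convention \<open>0 * \<infinity> = 0\<close>, which holds in both number systems, covers the zeros of the weight \<open>w\<close>.
\<close>

lemma e2ennreal_mult_ereal: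
  "0 \<le> w \<Longrightarrow> e2ennreal (a * ereal w) = ennreal w * e2ennreal a"
proof (cases a)
  case (real r)
  then show "0 \<le> w \<Longrightarrow> ?thesis"
    by (cases "0 \<le> r") (auto simp: ennreal_mult' mult.commute ennreal_neg mult_nonneg_nonpos2 mult_nonpos_nonneg)
next
  case PInf
  then show "0 \<le> w \<Longrightarrow> ?thesis"
    by (cases "w = 0") (auto simp: ennreal_mult_top zero_ereal_def[symmetric] e2ennreal_neg)
next
  case MInf
  then show "0 \<le> w \<Longrightarrow> ?thesis"
    by (cases "w = 0") (auto simp: zero_ereal_def[symmetric] e2ennreal_neg)
qed

text \<open>
This turns the cross entropy, an integral against \<open>\<mu>\<close> with weight \<open>f(_, \<theta>\<^sub>0)\<close>, into a mean under the
law of the observations.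
\<close>

lemma ereal_integral_density:
  assumes [measurable]: "u \<in> borel_measurable \<mu>" "w \<in> borel_measurable \<mu>" and "\<And>x. 0 \<le> w x"
  shows "ereal_integral \<mu> (\<lambda>x. u x * ereal (w x)) = ereal_integral (density \<mu> (\<lambda>x. ennreal (w x))) u"
  unfolding ereal_integral_def
  by (simp add: nn_integral_density e2ennreal_mult_ereal assms(3) ereal_mult_minus_left[symmetric]
      del: ereal_mult_minus_left)

lemma (in prob_space) ereal_integral_eq_expectation:
  fixes u :: "'a \<Rightarrow> ereal"
  assumes [measurable]: "u \<in> borel_measurable M"
    and finite: "\<And>x. u x < \<infinity>"
    and pos: "(\<integral>\<^sup>+ x. e2ennreal (u x) \<partial>M) < \<infinity>"
    and lower: "- \<infinity> < ereal_integral M u"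
  shows "AE x in M. u x \<noteq> - \<infinity>"
    and "integrable M (\<lambda>x. real_of_ereal (u x))"
    and "ereal_integral M u = ereal (expectation (\<lambda>x. real_of_ereal (u x)))"
proof -
  have neg: "(\<integral>\<^sup>+ x. e2ennreal (- u x) \<partial>M) < \<infinity>"
    using lower pos unfolding ereal_integral_def
    by (cases "\<integral>\<^sup>+ x. e2ennreal (- u x) \<partial>M"; cases "\<integral>\<^sup>+ x. e2ennreal (u x) \<partial>M") auto
  have "AE x in M. e2ennreal (- u x) \<noteq> \<infinity>"
    using neg by (intro nn_integral_PInf_AE) auto
  then show AE: "AE x in M. u x \<noteq> - \<infinity>"
    by eventually_elim auto
  have pos_eq: "(\<integral>\<^sup>+ x. ennreal (real_of_ereal (u x)) \<partial>M) = (\<integral>\<^sup>+ x. e2ennreal (u x) \<partial>M)"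
  proof (intro nn_integral_cong)
    show "ennreal (real_of_ereal (u x)) = e2ennreal (u x)" for x
      using finite[of x] by (cases "u x") (auto simp: e2ennreal_neg)
  qed
  have neg_eq: "(\<integral>\<^sup>+ x. ennreal (- real_of_ereal (u x)) \<partial>M) = (\<integral>\<^sup>+ x. e2ennreal (- u x) \<partial>M)"
  proof (intro nn_integral_cong_AE, use AE in eventually_elim)
    show "ennreal (- real_of_ereal (u x)) = e2ennreal (- u x)" if "u x \<noteq> - \<infinity>" for x
      using finite[of x] that by (cases "u x") auto
  qed
  show int: "integrable M (\<lambda>x. real_of_ereal (u x))"
    using pos neg by (auto simp: real_integrable_def pos_eq neg_eq)
  show "ereal_integral M u = ereal (expectation (\<lambda>x. real_of_ereal (u x)))"
    using pos neg unfolding real_lebesgue_integral_def[OF int] pos_eq neg_eq ereal_integral_def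
    by (cases "\<integral>\<^sup>+ x. e2ennreal (- u x) \<partial>M"; cases "\<integral>\<^sup>+ x. e2ennreal (u x) \<partial>M") auto
qed

text \<open>
Truncation from below gives integrable functions that decrease to \<open>v\<close>; by monotone convergence of the
negative parts, their means decrease to the integral of \<open>v\<close> even if that is \<open>-\<infinity>\<close>. A strict
upper bound on the integral therefore holds already for some truncation.
\<close>

lemma (in prob_space) truncated_expectation_less:
  fixes v :: "'a \<Rightarrow> ereal"
  assumes [measurable]: "v \<in> borel_measurable M"
    and finite: "\<And>x. v x < \<infinity>"
    and pos: "(\<integral>\<^sup>+ x. e2ennreal (v x) \<partial>M) < \<infinity>"
    and less: "ereal_integral M v < ereal t"
  obtains K :: nat
  where "integrable M (\<lambda>x. real_of_ereal (max (- ereal (real K)) (v x)))"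
    and "expectation (\<lambda>x. real_of_ereal (max (- ereal (real K)) (v x))) < t"
proof -
  let ?p = "\<lambda>x. real_of_ereal (max 0 (v x))"
  let ?m = "\<lambda>K::nat. \<lambda>x. min (ennreal (real K)) (e2ennreal (- v x))"
  have p_eq: "ennreal (?p x) = e2ennreal (v x)" for x
    using finite[of x] by (cases "v x") (auto simp: e2ennreal_neg ennreal_neg max_def)
  have p0: "0 \<le> ?p x" for x
    by (simp add: real_of_ereal_pos)
  have int_p: "integrable M ?p"
    using pos by (intro integrableI_nonneg) (auto simp: p_eq p0)
  have nn_p: "(\<integral>\<^sup>+ x. e2ennreal (v x) \<partial>M) = ennreal (expectation ?p)"
    using nn_integral_eq_integral[OF int_p] p0 by (simp add: p_eq)
  have Ep: "0 \<le> expectation ?p"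
    by (simp add: p0)
  have SUP_m: "(SUP K. ?m K x) = e2ennreal (- v x)" for x
  proof -
    have top: "(SUP K::nat. ennreal (real K)) = top"
      using ennreal_SUP_of_nat_eq_top by (simp only: ennreal_of_nat_eq_real_of_nat)
    have "(SUP K. ?m K x) = (SUP K::nat. inf (e2ennreal (- v x)) (ennreal (real K)))"
      by (simp only: inf_min min.commute)
    also have "\<dots> = inf (e2ennreal (- v x)) (SUP K::nat. ennreal (real K))"
      by (rule inf_SUP[symmetric])
    finally show ?thesis
      by (simp only: top inf_top_right)
  qed
  have SUP_int: "(\<integral>\<^sup>+ x. e2ennreal (- v x) \<partial>M) = (SUP K. \<integral>\<^sup>+ x. ?m K x \<partial>M)"
  proof -
    have "incseq ?m"
      unfolding incseq_def le_fun_def by (intro allI impI min.mono ennreal_leI) simp_all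
    then have "(\<integral>\<^sup>+ x. (SUP K. ?m K x) \<partial>M) = (SUP K. \<integral>\<^sup>+ x. ?m K x \<partial>M)"
      by (rule nn_integral_monotone_convergence_SUP) measurable
    then show ?thesis
      by (simp only: SUP_m)
  qed
  \<comment> \<open>The bound \<open>t\<close> is compared with the truncated negative part only; the positive part does not depend on \<open>K\<close>. If \<open>t\<close> exceeds its mean, any \<open>K\<close> works.\<close>
  have "\<exists>K. ereal (expectation ?p - t) < enn2ereal (\<integral>\<^sup>+ x. ?m K x \<partial>M)"
  proof (cases "expectation ?p < t")
    case True
    have "ereal (expectation ?p - t) < 0"
      using True by (simp add: zero_ereal_def)
    then show ?thesis
      using enn2ereal_nonneg less_le_trans by blast
  next
    case False
    have "ennreal (expectation ?p - t) < (\<integral>\<^sup>+ x. e2ennreal (- v x) \<partial>M)"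
      using less False Ep unfolding ereal_integral_def nn_p
      by (cases "\<integral>\<^sup>+ x. e2ennreal (- v x) \<partial>M") (auto simp: ennreal_less_iff)
    then obtain K where "ennreal (expectation ?p - t) < (\<integral>\<^sup>+ x. ?m K x \<partial>M)"
      unfolding SUP_int less_SUP_iff by auto
    then show ?thesis
      using False by (auto simp: less_ennreal.rep_eq intro!: exI[of _ K])
  qed
  then obtain K where K: "ereal (expectation ?p - t) < enn2ereal (\<integral>\<^sup>+ x. ?m K x \<partial>M)"
    by blast
  let ?n = "\<lambda>x. enn2real (?m K x)"
  have n_eq: "ennreal (?n x) = ?m K x" for x
    by (intro ennreal_enn2real) (auto simp: min_less_iff_disj)
  have int_n: "integrable M ?n"
    by (rule integrable_const_bound[of _ "real K"]) (auto intro!: enn2real_leI)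
  have nn_n: "(\<integral>\<^sup>+ x. ?m K x \<partial>M) = ennreal (expectation ?n)"
    using nn_integral_eq_integral[OF int_n] by (simp add: n_eq)
  have eq: "real_of_ereal (max (- ereal (real K)) (v x)) = ?p x - ?n x" for x
  proof (cases "v x")
    case (real r)
    then show ?thesis
      by (cases "0 \<le> r"; cases "- real K \<le> r") (auto simp: max_def min_def ennreal_neg)
  qed (use finite[of x] in \<open>auto simp: max_def\<close>)
  show ?thesis
  proof (rule that[of K]; unfold eq)
    show "integrable M (\<lambda>x. ?p x - ?n x)"
      using int_p int_n by simp
    show "expectation (\<lambda>x. ?p x - ?n x) < t"
      using int_p int_n K unfolding nn_n by simp
  qed
qed

section \<open>Cross entropy of densities\<close>

text \<open>
From \<open>log y \<le> y\<close> with \<open>y = g / h\<close> one gets \<open>h log g \<le> h |log h| + g\<close>, and the right-hand side has finite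
integral. So the cross entropy relative to \<open>h\<close> is never \<open>-\<infinity>\<close> and never of the form \<open>\<infinity> - \<infinity>\<close>.
\<close>

lemma nn_integral_pos_log_density_finite:
  assumes g: "is_density \<mu> g" and h: "is_density \<mu> h"
    and int: "(\<integral>\<^sup>+ x. e2ennreal (\<bar>elog (h x)\<bar> * ereal (h x)) \<partial>\<mu>) < \<infinity>"
  shows "(\<integral>\<^sup>+ x. e2ennreal (elog (g x)) \<partial>density \<mu> (\<lambda>x. ennreal (h x))) < \<infinity>"
proof -
  have [measurable]: "g \<in> borel_measurable \<mu>" "h \<in> borel_measurable \<mu>"
    and g0: "\<And>x. 0 \<le> g x" and h0: "\<And>x. 0 \<le> h x"
    using g h by (auto simp: is_density_def)
  have "(\<integral>\<^sup>+ x. e2ennreal (elog (g x)) \<partial>density \<mu> (\<lambda>x. ennreal (h x)))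
      = (\<integral>\<^sup>+ x. ennreal (h x) * e2ennreal (elog (g x)) \<partial>\<mu>)"
    by (rule nn_integral_density) auto
  also have "\<dots> \<le> (\<integral>\<^sup>+ x. e2ennreal (\<bar>elog (h x)\<bar> * ereal (h x)) + ennreal (g x) \<partial>\<mu>)"
  proof (rule nn_integral_mono)
    fix x
    show "ennreal (h x) * e2ennreal (elog (g x)) \<le> e2ennreal (\<bar>elog (h x)\<bar> * ereal (h x)) + ennreal (g x)"
    proof (cases "h x = 0 \<or> g x = 0")
      case True
      then show ?thesis by (auto simp: elog_def e2ennreal_neg)
    next
      case False
      then have pos: "0 < h x" "0 < g x"
        using g0[of x] h0[of x] by auto
      have "ln (g x) = ln (h x) + ln (g x / h x)"
        using pos by (simp add: ln_div)
      also have "\<dots> \<le> \<bar>ln (h x)\<bar> + g x / h x"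
        using ln_le_minus_one[of "g x / h x"] pos by simp
      finally have "h x * ln (g x) \<le> h x * (\<bar>ln (h x)\<bar> + g x / h x)"
        using pos by (intro mult_left_mono) auto
      also have "\<dots> = \<bar>ln (h x)\<bar> * h x + g x"
        using pos by (simp add: field_simps)
      finally have "ennreal (h x * ln (g x)) \<le> ennreal (\<bar>ln (h x)\<bar> * h x + g x)"
        by (rule ennreal_leI)
      then show ?thesis
        using pos by (simp add: elog_def ennreal_mult' ennreal_plus)
    qed
  qed
  also have "\<dots> = (\<integral>\<^sup>+ x. e2ennreal (\<bar>elog (h x)\<bar> * ereal (h x)) \<partial>\<mu>) + 1"
    using g by (subst nn_integral_add) (auto simp: is_density_def)
  also have "\<dots> < \<infinity>"
    using int by simp
  finally show ?thesis .
qed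

lemma cross_entropy_eq_ereal_integral:
  assumes "is_density \<mu> (\<lambda>x. f x \<theta>)" "is_density \<mu> (\<lambda>x. f x \<theta>\<^sub>0)"
  shows "cross_entropy \<mu> f \<theta> \<theta>\<^sub>0
    = - ereal_integral (density \<mu> (\<lambda>x. ennreal (f x \<theta>\<^sub>0))) (\<lambda>x. elog (f x \<theta>))"
  unfolding cross_entropy_def using assms
  by (subst ereal_integral_density) (auto simp: is_density_def)

lemma cross_entropy_self_finite:
  assumes dens: "is_density \<mu> (\<lambda>x. f x \<theta>)"
    and int: "(\<integral>\<^sup>+ x. e2ennreal (\<bar>elog (f x \<theta>)\<bar> * ereal (f x \<theta>)) \<partial>\<mu>) < \<infinity>"
  shows "\<bar>cross_entropy \<mu> f \<theta> \<theta>\<bar> \<noteq> \<infinity>"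
proof -
  have nn: "0 \<le> ereal (f x \<theta>)" for x
    using dens by (simp add: is_density_def)
  have abs_ge: "a \<le> \<bar>a\<bar>" "- a \<le> \<bar>a\<bar>" for a :: ereal
    by (cases a; simp)+
  have "(\<integral>\<^sup>+ x. e2ennreal (elog (f x \<theta>) * ereal (f x \<theta>)) \<partial>\<mu>)
      \<le> (\<integral>\<^sup>+ x. e2ennreal (\<bar>elog (f x \<theta>)\<bar> * ereal (f x \<theta>)) \<partial>\<mu>)"
    by (intro nn_integral_mono e2ennreal_mono ereal_mult_right_mono nn) (rule abs_ge)
  moreover have "(\<integral>\<^sup>+ x. e2ennreal (- (elog (f x \<theta>) * ereal (f x \<theta>))) \<partial>\<mu>)
      \<le> (\<integral>\<^sup>+ x. e2ennreal (\<bar>elog (f x \<theta>)\<bar> * ereal (f x \<theta>)) \<partial>\<mu>)"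
    unfolding ereal_mult_minus_left[symmetric]
    by (intro nn_integral_mono e2ennreal_mono ereal_mult_right_mono nn) (rule abs_ge)
  ultimately show ?thesis
    using int unfolding cross_entropy_def ereal_integral_def
    by (cases "\<integral>\<^sup>+ x. e2ennreal (elog (f x \<theta>) * ereal (f x \<theta>)) \<partial>\<mu>";
        cases "\<integral>\<^sup>+ x. e2ennreal (- (elog (f x \<theta>) * ereal (f x \<theta>))) \<partial>\<mu>") auto
qed

section \<open>Drift of the log-likelihood difference\<close>

text \<open>
Here \<open>u\<close> and \<open>v\<close> stand for the logarithms of the densities with the smaller and the larger cross
entropy. Only \<open>v\<close> is truncated: a lower truncation of \<open>u\<close> would bound the difference from the
wrong side, and \<open>u\<close> is integrable.
\<close>

lemma (in prob_space) iid_truncated_difference_drift: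
  fixes Y :: "nat \<Rightarrow> 'a \<Rightarrow> 'b" and u v :: "'b \<Rightarrow> ereal"
  assumes indep: "indep_vars (\<lambda>_. N) Y UNIV"
    and law: "\<And>i. distr M N (Y i) = P"
    and meas[measurable]: "u \<in> borel_measurable N" "v \<in> borel_measurable N"
    and finite: "\<And>x. u x < \<infinity>" "\<And>x. v x < \<infinity>"
    and pos: "(\<integral>\<^sup>+ x. e2ennreal (u x) \<partial>P) < \<infinity>" "(\<integral>\<^sup>+ x. e2ennreal (v x) \<partial>P) < \<infinity>"
    and lower: "- \<infinity> < ereal_integral P u"
    and less: "ereal_integral P v < ereal_integral P u"
  obtains K :: nat where "AE \<omega> in M. (\<forall>i. u (Y i \<omega>) \<noteq> - \<infinity>) \<and>
    (LIM n sequentially. (\<Sum>i<n. real_of_ereal (max (- ereal (real K)) (v (Y i \<omega>)))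
      - real_of_ereal (u (Y i \<omega>))) :> at_bot)"
proof -
  have Y[measurable]: "Y i \<in> M \<rightarrow>\<^sub>M N" for i
    using indep by (simp add: indep_vars_def2)
  have [measurable_cong]: "sets P = sets N"
    using law[of 0] by auto
  interpret P: prob_space P
    using prob_space_distr[OF Y[of 0]] by (simp add: law)
  have "u \<in> borel_measurable P" "v \<in> borel_measurable P"
    by measurable
  note u = P.ereal_integral_eq_expectation[OF this(1) finite(1) pos(1) lower]
    and v = P.truncated_expectation_less[OF this(2) finite(2) pos(2) less[unfolded u(3)]]
  obtain K :: nat
    where int_K: "integrable P (\<lambda>x. real_of_ereal (max (- ereal (real K)) (v x)))"
      and less_K: "P.expectation (\<lambda>x. real_of_ereal (max (- ereal (real K)) (v x)))
        < P.expectation (\<lambda>x. real_of_ereal (u x))"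
    by (rule v)
  define d where "d x = real_of_ereal (max (- ereal (real K)) (v x)) - real_of_ereal (u x)" for x
  have d[measurable]: "d \<in> borel_measurable N"
    unfolding d_def by measurable
  have int_d: "integrable P d" and neg_d: "P.expectation d < 0"
    using int_K u(2) less_K by (simp_all add: d_def[abs_def])
  have "AE \<omega> in M. LIM n sequentially. (\<Sum>i<n. d (Y i \<omega>)) :> at_bot"
  proof (rule iid_negative_drift)
    show "indep_vars (\<lambda>_. borel) (\<lambda>i \<omega>. d (Y i \<omega>)) UNIV"
      using indep by (rule indep_vars_compose2) simp
    have "distr M borel (\<lambda>\<omega>. d (Y i \<omega>)) = distr P borel d" for i
      using distr_distr[OF d Y[of i]] by (simp add: law comp_def)
    then show "distr M borel (\<lambda>\<omega>. d (Y i \<omega>)) = distr M borel (\<lambda>\<omega>. d (Y 0 \<omega>))" for i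
      by simp
    show "integrable M (\<lambda>\<omega>. d (Y 0 \<omega>))"
      using int_d integrable_distr_eq[OF Y[of 0] d] by (simp add: law)
    show "expectation (\<lambda>\<omega>. d (Y 0 \<omega>)) < 0"
      using neg_d integral_distr[OF Y[of 0] d] by (simp add: law)
  qed
  moreover have "AE \<omega> in M. \<forall>i. u (Y i \<omega>) \<noteq> - \<infinity>"
  proof (subst AE_all_countable, rule allI)
    show "AE \<omega> in M. u (Y i \<omega>) \<noteq> - \<infinity>" for i
      using u(1) unfolding law[of i, symmetric] by (rule AE_distrD[OF Y])
  qed
  ultimately have "AE \<omega> in M. (\<forall>i. u (Y i \<omega>) \<noteq> - \<infinity>) \<and>
      (LIM n sequentially. (\<Sum>i<n. d (Y i \<omega>)) :> at_bot)"
    by eventually_elim simp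
  then show thesis
    unfolding d_def by (rule that)
qed

text \<open>
The truncation only increases \<open>log f(_, \<phi>)\<close>, so it gives an upper bound. If some factor of the
likelihood at \<open>\<phi>\<close> vanishes, the left-hand side is \<open>-\<infinity>\<close>; at \<open>\<theta>\<close> this has to be excluded, since it
would make the left-hand side \<open>\<infinity>\<close>.
\<close>

lemma neg_log_likelihood_diff_le:
  assumes nonneg: "\<And>i. 0 \<le> f (X i \<omega>) \<theta>" "\<And>i. 0 \<le> f (X i \<omega>) \<phi>"
    and pos: "\<And>i. elog (f (X (Suc i) \<omega>) \<theta>) \<noteq> - \<infinity>"
  shows "- elog (likelihood f X n \<omega> \<theta>) - (- elog (likelihood f X n \<omega> \<phi>))
    \<le> ereal (\<Sum>i<n. real_of_ereal (max (- ereal c) (elog (f (X (Suc i) \<omega>) \<phi>)))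
        - real_of_ereal (elog (f (X (Suc i) \<omega>) \<theta>)))"
proof -
  have f_pos: "f (X (Suc i) \<omega>) \<theta> \<noteq> 0" for i
    using pos[of i] unfolding elog_def by (rule contrapos_nn) simp
  have lik: "elog (likelihood f X n \<omega> t) = elog (\<Prod>i<n. f (X (Suc i) \<omega>) t)" for t
    by (simp add: likelihood_def prod.atLeast1_atMost_eq)
  have \<theta>: "elog (likelihood f X n \<omega> \<theta>) = ereal (\<Sum>i<n. real_of_ereal (elog (f (X (Suc i) \<omega>) \<theta>)))"
    unfolding lik using nonneg f_pos by (subst elog_prod) (auto simp: elog_def)
  have "elog (likelihood f X n \<omega> \<phi>)
      \<le> ereal (\<Sum>i<n. real_of_ereal (max (- ereal c) (elog (f (X (Suc i) \<omega>) \<phi>))))"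
    unfolding lik using nonneg
    by (subst elog_prod) (auto simp: elog_def max_def intro!: sum_mono)
  then show ?thesis
    unfolding \<theta> by (cases "elog (likelihood f X n \<omega> \<phi>)") (auto simp: sum_subtractf)
qed

section \<open>Separation by the log-likelihood\<close>

theorem theorem4p1:
  fixes M :: "'w measure"
    and X :: "nat \<Rightarrow> 'w \<Rightarrow> real ^ 'p"
    and \<mu> :: "(real ^ 'p) measure"
    and f :: "real ^ 'p \<Rightarrow> real ^ 'q \<Rightarrow> real"
    and \<Theta> :: "(real ^ 'q) set"
    and \<theta>\<^sub>0 :: "real ^ 'q"
    and \<delta> :: "real \<Rightarrow> real"
  assumes "prob_space M"
    and "sigma_finite_measure \<mu>" and "sets \<mu> = sets borel"
    and "\<And>\<theta>. \<theta> \<in> \<Theta> \<Longrightarrow> is_density \<mu> (\<lambda>x. f x \<theta>)"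
    and "\<theta>\<^sub>0 \<in> \<Theta>"
    and "prob_space.indep_vars M (\<lambda>_. borel) X {1..}"
    and "\<And>i. i \<ge> 1 \<Longrightarrow> distributed M \<mu> (X i) (\<lambda>x. ennreal (f x \<theta>\<^sub>0))"
    and identifiable:
      "\<And>\<theta>\<^sub>1 \<theta>\<^sub>2. \<theta>\<^sub>1 \<in> \<Theta> \<Longrightarrow> \<theta>\<^sub>2 \<in> \<Theta> \<Longrightarrow> (AE x in \<mu>. f x \<theta>\<^sub>1 = f x \<theta>\<^sub>2) \<Longrightarrow> \<theta>\<^sub>1 = \<theta>\<^sub>2"
    and integrable_log:
      "\<And>\<theta>. \<theta> \<in> \<Theta> \<Longrightarrow> (\<integral>\<^sup>+ x. e2ennreal (\<bar>elog (f x \<theta>)\<bar> * ereal (f x \<theta>)) \<partial>\<mu>) < \<infinity>"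
    and continuous_s:
      "\<And>\<theta>'. \<theta>' \<in> \<Theta> \<Longrightarrow> continuous_on \<Theta> (\<lambda>\<theta>. cross_entropy \<mu> f \<theta> \<theta>')"
    and boundary_s:
      "\<And>\<theta>' b. \<theta>' \<in> \<Theta> \<Longrightarrow> b \<in> extended_closure \<Theta> - Some ` \<Theta> \<Longrightarrow>
         Liminf (approach_within b \<Theta>) (\<lambda>\<theta>. cross_entropy \<mu> f \<theta> \<theta>') > cross_entropy \<mu> f \<theta>' \<theta>'"
    and delta:
      "\<And>\<epsilon>. \<epsilon> > 0 \<Longrightarrow> \<delta> \<epsilon> > 0 \<and> divergence_nbhd \<mu> f \<Theta> \<theta>\<^sub>0 (\<delta> \<epsilon>) \<subseteq> cball \<theta>\<^sub>0 \<epsilon>"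
  shows "\<forall>\<epsilon>>0. weakly_separates M (\<lambda>n \<omega> \<theta>. - elog (likelihood f X n \<omega> \<theta>))
           (divergence_nbhd \<mu> f \<Theta> \<theta>\<^sub>0 (\<delta> \<epsilon>)) (\<Theta> - divergence_nbhd \<mu> f \<Theta> \<theta>\<^sub>0 (\<delta> \<epsilon>))"
  unfolding weakly_separates_def
proof (intro allI impI ballI)
  fix \<epsilon> :: real and \<theta> \<phi>
  assume "\<epsilon> > 0"
    and \<theta>: "\<theta> \<in> divergence_nbhd \<mu> f \<Theta> \<theta>\<^sub>0 (\<delta> \<epsilon>)"
    and \<phi>: "\<phi> \<in> \<Theta> - divergence_nbhd \<mu> f \<Theta> \<theta>\<^sub>0 (\<delta> \<epsilon>)"
  interpret prob_space M by fact
  have in_\<Theta>: "\<theta> \<in> \<Theta>" "\<phi> \<in> \<Theta>"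
    using \<theta> \<phi> by (auto simp: divergence_nbhd_def)
  note dens = assms(4) and \<theta>\<^sub>0 = \<open>\<theta>\<^sub>0 \<in> \<Theta>\<close>
  let ?P = "density \<mu> (\<lambda>x. ennreal (f x \<theta>\<^sub>0))"
  let ?s = "\<lambda>t. cross_entropy \<mu> f t \<theta>\<^sub>0"
  have s_eq: "?s t = - ereal_integral ?P (\<lambda>x. elog (f x t))" if "t \<in> \<Theta>" for t
    using that \<theta>\<^sub>0 by (intro cross_entropy_eq_ereal_integral dens)
  have "\<bar>?s \<theta>\<^sub>0\<bar> \<noteq> \<infinity>"
    using \<theta>\<^sub>0 by (intro cross_entropy_self_finite dens integrable_log)
  \<comment> \<open>Subtracting the finite number \<open>s(\<theta>\<^sub>0, \<theta>\<^sub>0)\<close> preserves the order, so \<open>\<delta> \<epsilon>\<close> separates the two cross entropies.\<close>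
  then have s_less: "?s \<theta> < ?s \<phi>" and s_fin: "?s \<theta> < \<infinity>"
    using \<theta> \<phi> by (cases "?s \<theta>\<^sub>0"; cases "?s \<theta>"; cases "?s \<phi>"; auto simp: divergence_nbhd_def)+
  have pos: "(\<integral>\<^sup>+ x. e2ennreal (elog (f x t)) \<partial>?P) < \<infinity>" if "t \<in> \<Theta>" for t
    using that \<theta>\<^sub>0 by (intro nn_integral_pos_log_density_finite dens integrable_log)
  have meas: "(\<lambda>x. elog (f x t)) \<in> borel_measurable borel" if "t \<in> \<Theta>" for t
  proof -
    have "(\<lambda>x. f x t) \<in> borel_measurable \<mu>"
      using dens[OF that] by (simp add: is_density_def)
    then have "(\<lambda>x. f x t) \<in> borel_measurable borel"
      by (simp cong: measurable_cong_sets add: \<open>sets \<mu> = sets borel\<close>)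
    then show ?thesis by measurable
  qed
  obtain K :: nat where "AE \<omega> in M. (\<forall>i. elog (f (X (Suc i) \<omega>) \<theta>) \<noteq> - \<infinity>) \<and>
    (LIM n sequentially. (\<Sum>i<n. real_of_ereal (max (- ereal (real K)) (elog (f (X (Suc i) \<omega>) \<phi>)))
      - real_of_ereal (elog (f (X (Suc i) \<omega>) \<theta>))) :> at_bot)"
  proof (rule iid_truncated_difference_drift[where Y = "\<lambda>i. X (Suc i)" and N = borel and P = ?P
        and u = "\<lambda>x. elog (f x \<theta>)" and v = "\<lambda>x. elog (f x \<phi>)"])
    show "indep_vars (\<lambda>_. borel) (\<lambda>i. X (Suc i)) UNIV"
      using assms(6) by (intro indep_vars_reindex_inj[where h = Suc]) (simp_all add: atLeast_Suc_greaterThan greaterThan_0)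
    show "distr M borel (X (Suc i)) = ?P" for i
      using assms(7)[of "Suc i"] \<open>sets \<mu> = sets borel\<close>
      by (metis distr_cong distributed_distr_eq_density le_add1 plus_1_eq_Suc)
    show "- \<infinity> < ereal_integral ?P (\<lambda>x. elog (f x \<theta>))"
      using s_fin unfolding s_eq[OF in_\<Theta>(1)] by (cases "ereal_integral ?P (\<lambda>x. elog (f x \<theta>))") auto
    show "ereal_integral ?P (\<lambda>x. elog (f x \<phi>)) < ereal_integral ?P (\<lambda>x. elog (f x \<theta>))"
      using s_less unfolding s_eq[OF in_\<Theta>(1)] s_eq[OF in_\<Theta>(2)] by simp
  qed (use in_\<Theta> meas pos elog_less_infinity in auto)
  then show "AE \<omega> in M. limsup (\<lambda>n. - elog (likelihood f X n \<omega> \<theta>) - - elog (likelihood f X n \<omega> \<phi>)) < 0"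
  proof eventually_elim
    case (elim \<omega>)
    then have "\<forall>\<^sub>F n in sequentially. (\<Sum>i<n. real_of_ereal (max (- ereal (real K)) (elog (f (X (Suc i) \<omega>) \<phi>)))
        - real_of_ereal (elog (f (X (Suc i) \<omega>) \<theta>))) \<le> - 1"
      by (auto simp: filterlim_at_bot)
    then have "\<forall>\<^sub>F n in sequentially.
        - elog (likelihood f X n \<omega> \<theta>) - - elog (likelihood f X n \<omega> \<phi>) \<le> ereal (- 1)"
    proof eventually_elim
      case (elim n)
      have "0 \<le> f x \<theta>" "0 \<le> f x \<phi>" for x
        using dens in_\<Theta> by (auto simp: is_density_def)
      then show ?case
        using elim \<open>(\<forall>i. elog (f (X (Suc i) \<omega>) \<theta>) \<noteq> - \<infinity>) \<and> _\<close>
        by (intro order_trans[OF neg_log_likelihood_diff_le[where c = "real K"]]) auto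
    qed
    then have "limsup (\<lambda>n. - elog (likelihood f X n \<omega> \<theta>) - - elog (likelihood f X n \<omega> \<phi>)) \<le> ereal (- 1)"
      by (rule Limsup_bounded)
    also have "\<dots> < 0"
      by simp
    finally show ?case .
  qed
qed

end
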